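(* For every frame $L$, there is an isomorphism $\mathsf{S}_b(L)\cong \mathcal{AU}(\mathsf{LC}(L))$ (an order-isomorphism, equivalently an isomorphism of frames, both sides being ordered by inclusion).
   Context: For a frame $L$ with Heyting implication $\to$, a sublocale of $L$ is a subset $S\subseteq L$ closed under arbitrary meets and such that $a\to s\in S$ for all $a\in L$, $s\in S$. The set $\mathsf{S}(L)$ of all sublocales, ordered by inclusion, is a coframe in which meets are intersections and $\bigvee_i S_i=\{\bigwedge N\mid N\subseteq\bigcup_i S_i\}$. For $a\in L$, the closed and open sublocales are $\mathfrak{c}(a)=\{b\in L\mid b\ge a\}$ and $\mathfrak{o}(a)=\{a\to b\mid b\in L\}$; they are complements of each other in $\mathsf{S}(L)$. A sublocale is locally closed if it is of the form $\mathfrak{c}(a)\cap\mathfrak{o}(b)$ with $a,b\in L$. $\mathsf{S}_b(L)$ denotes the set of all joins in $\mathsf{S}(L)$ of families of locally closed sublocales, ordered by inclusion; it is a complete Boolean algebra. Let $\mathsf{LC}(L)=\{(a,b)\in L\times L\mid a\le b,\ b\to a=a\}$, with the partial order $(x,y)\sqsubseteq(a,b)$ iff $x\le a$ and $b\le a\vee y$ (equivalently, $\mathfrak{c}(a)\cap\mathfrak{o}(b)\subseteq\mathfrak{c}(x)\cap\mathfrak{o}(y)$). This is a join-semilattice, anti-isomorphic to the poset of locally closed sublocales of $L$ via $(a,b)\mapsto\mathfrak{c}(a)\cap\mathfrak{o}(b)$. In a join-semilattice $S$, a family $\{a_i\}_{i\in I}$ is admissible if its meet exists in $S$ and, for each $b\in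 S$, the meet $\bigwedge_{i}(b\vee a_i)$ exists and equals $b\vee\bigwedge_i a_i$. A nonempty upper set $U\subseteq S$ is admissible if $\bigwedge_i a_i\in U$ for every admissible family $\{a_i\}_{i\in I}\subseteq U$. $\mathcal{AU}(S)$ is the set of all admissible (nonempty) upper sets of $S$, ordered by inclusion (the Bruns--Lakser completion of $S$). *)

theory Defs
  imports "HOL-Library.Lub_Glb"
begin

text \<open>The library class \<open>complete_distrib_lattice\<close> demands complete distributivity, which is
  strictly stronger than the frame law, so frames get a class of their own.\<close>

class frame = complete_lattice +
  assumes inf_Sup_frame: "inf a (Sup B) = Sup (inf a ` B)"
begin

definition himp :: "'a \<Rightarrow> 'a \<Rightarrow> 'a"
  where "himp a b = Sup {c. inf c a \<le> b}"

lemma inf_le_iff_le_himp: "inf c a \<le> b \<longleftrightarrow> c \<le> himp a b"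
proof
  show "c \<le> himp a b" if "inf c a \<le> b"
    unfolding himp_def using that by (auto intro: Sup_upper)
next
  assume "c \<le> himp a b"
  then have "inf c a \<le> inf a (himp a b)"
    by (metis inf_commute inf_mono order_refl)
  also have "\<dots> = Sup (inf a ` {c. inf c a \<le> b})"
    unfolding himp_def by (rule inf_Sup_frame)
  also have "\<dots> \<le> b"
    by (rule Sup_least) (auto simp: inf_commute)
  finally show "inf c a \<le> b" .
qed

subclass distrib_lattice
proof (unfold_locales, rule distrib_imp1)
  fix x y z :: 'a
  show "inf x (sup y z) = sup (inf x y) (inf x z)"
    using inf_Sup_frame[of x "{y, z}"] by simp
qed

lemma himp_Inf: "himp a (Inf N) = Inf (himp a ` N)"
proof (rule order.antisym)
  show "himp a (Inf N) \<le> Inf (himp a ` N)"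
    by (rule Inf_greatest)
      (metis (no_types, lifting) imageE inf_le_iff_le_himp Inf_lower order_refl order_trans)
  show "Inf (himp a ` N) \<le> himp a (Inf N)"
    by (subst inf_le_iff_le_himp[symmetric], rule Inf_greatest)
      (simp add: inf_le_iff_le_himp Inf_lower)
qed

lemma himp_himp: "himp a (himp b c) = himp b (himp a c)"
proof -
  have "x \<le> himp a (himp b c) \<longleftrightarrow> x \<le> himp b (himp a c)" for x
    by (simp add: inf_le_iff_le_himp[symmetric] inf.assoc inf.commute inf.left_commute)
  then show ?thesis by (meson order.antisym order_refl)
qed

end

definition sublocale_of :: "'a::frame set \<Rightarrow> bool"
  where "sublocale_of S \<longleftrightarrow> (\<forall>M\<subseteq>S. Inf M \<in> S) \<and> (\<forall>a. \<forall>s\<in>S. himp a s \<in> S)"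

definition sublocale_Join :: "'a::frame set set \<Rightarrow> 'a set"
  where "sublocale_Join F = {Inf N | N. N \<subseteq> \<Union>F}"

definition closed_sublocale :: "'a::frame \<Rightarrow> 'a set"
  where "closed_sublocale a = {b. a \<le> b}"

definition open_sublocale :: "'a::frame \<Rightarrow> 'a set"
  where "open_sublocale a = range (himp a)"

definition locally_closed :: "'a::frame set \<Rightarrow> bool"
  where "locally_closed S \<longleftrightarrow>
    sublocale_of S \<and> (\<exists>a b. S = closed_sublocale a \<inter> open_sublocale b)"

definition Sb :: "'a::frame set set"
  where "Sb = {sublocale_Join F | F. \<forall>S\<in>F. locally_closed S}"

lemma sublocale_Join_is_join:
  assumes "\<And>S. S \<in> F \<Longrightarrow> sublocale_of S"
  shows "sublocale_of (sublocale_Join F)"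
    and "\<And>S. S \<in> F \<Longrightarrow> S \<subseteq> sublocale_Join F"
    and "\<And>T. sublocale_of T \<Longrightarrow> (\<And>S. S \<in> F \<Longrightarrow> S \<subseteq> T) \<Longrightarrow> sublocale_Join F \<subseteq> T"
proof -
  show "sublocale_of (sublocale_Join F)"
    unfolding sublocale_of_def
  proof (intro conjI allI ballI impI)
    fix M assume "M \<subseteq> sublocale_Join F"
    then have "\<forall>m\<in>M. \<exists>N. N \<subseteq> \<Union>F \<and> m = Inf N"
      by (auto simp: sublocale_Join_def)
    then obtain N where N: "\<And>m. m \<in> M \<Longrightarrow> N m \<subseteq> \<Union>F \<and> m = Inf (N m)"
      by metis
    have "Inf M = Inf (\<Union>m\<in>M. N m)"
    proof (rule antisym)
      show "Inf M \<le> Inf (\<Union>m\<in>M. N m)"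
        by (rule Inf_greatest) (metis N Inf_lower UN_E order_trans)
      show "Inf (\<Union>m\<in>M. N m) \<le> Inf M"
        by (rule Inf_greatest) (metis N Inf_superset_mono UN_upper)
    qed
    then show "Inf M \<in> sublocale_Join F"
      using N unfolding sublocale_Join_def by blast
  next
    fix a s assume "s \<in> sublocale_Join F"
    then obtain N where N: "N \<subseteq> \<Union>F" "s = Inf N"
      by (auto simp: sublocale_Join_def)
    have "himp a n \<in> \<Union>F" if "n \<in> N" for n
    proof -
      obtain S where "S \<in> F" "n \<in> S" using N(1) \<open>n \<in> N\<close> by blast
      then show ?thesis using assms[of S] unfolding sublocale_of_def by blast
    qed
    then have "himp a ` N \<subseteq> \<Union>F" by (rule image_subsetI)
    moreover have "himp a s = Inf (himp a ` N)" using N by (simp only: himp_Inf)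
    ultimately show "himp a s \<in> sublocale_Join F"
      unfolding sublocale_Join_def by blast
  qed
  show "S \<subseteq> sublocale_Join F" if "S \<in> F" for S
  proof
    fix s assume "s \<in> S"
    then have "{s} \<subseteq> \<Union>F" "s = Inf {s}" using that by auto
    then show "s \<in> sublocale_Join F" unfolding sublocale_Join_def by blast
  qed
  show "sublocale_Join F \<subseteq> T" if T: "sublocale_of T" and sub: "\<And>S. S \<in> F \<Longrightarrow> S \<subseteq> T" for T
  proof
    fix s assume "s \<in> sublocale_Join F"
    then obtain N where N: "N \<subseteq> \<Union>F" "s = Inf N"
      by (auto simp: sublocale_Join_def)
    then have "N \<subseteq> T" using sub by (meson Sup_least order_trans)
    then show "s \<in> T" using T N(2) by (simp add: sublocale_of_def)
  qed
qed

lemma locally_closedI: "locally_closed (closed_sublocale a \<inter> open_sublocale b)"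
proof -
  have "sublocale_of (closed_sublocale a)"
    unfolding sublocale_of_def closed_sublocale_def
    by (auto intro!: Inf_greatest simp: inf_le_iff_le_himp[symmetric] intro: le_infI1)
  moreover have "sublocale_of (open_sublocale b)"
    unfolding sublocale_of_def open_sublocale_def
  proof (intro conjI allI ballI impI)
    fix M assume "M \<subseteq> range (himp b)"
    then obtain N where "M = himp b ` N" by (auto simp: subset_image_iff)
    then show "Inf M \<in> range (himp b)" by (auto simp: himp_Inf[symmetric])
  next
    fix a s assume "s \<in> range (himp b)"
    then show "himp a s \<in> range (himp b)" by (auto simp: himp_himp[of a b])
  qed
  ultimately show ?thesis
    unfolding locally_closed_def by (auto simp: sublocale_of_def)
qed

typedef (overloaded) 'a LC = "{(a::'a::frame, b). a \<le> b \<and> himp b a = a}"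
proof
  have "himp top bot = (bot::'a)"
    by (metis bot.extremum_uniqueI inf_le_iff_le_himp inf_top.right_neutral order_refl)
  then show "(bot, top) \<in> {(a::'a, b). a \<le> b \<and> himp b a = a}" by simp
qed

text \<open>The pair \<open>(himp b a, sup b (himp b a))\<close> lies in \<open>LC\<close> and presents the same locally closed
  sublocale as the arbitrary pair \<open>(a, b)\<close>. Joins of pairs in \<open>LC\<close> are obtained by normalizing the
  pair presenting the intersection.\<close>

definition LC_normal :: "'a::frame \<Rightarrow> 'a \<Rightarrow> 'a LC"
  where "LC_normal a b = Abs_LC (himp b a, sup b (himp b a))"

instantiation LC :: (frame) semilattice_sup
begin

definition less_eq_LC :: "'a LC \<Rightarrow> 'a LC \<Rightarrow> bool"
  where "p \<le> q \<longleftrightarrow>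
    (case (Rep_LC p, Rep_LC q) of ((x, y), (a, b)) \<Rightarrow> x \<le> a \<and> b \<le> sup a y)"

definition less_LC :: "'a LC \<Rightarrow> 'a LC \<Rightarrow> bool"
  where "p < q \<longleftrightarrow> p \<le> q \<and> \<not> q \<le> p" for p q :: "'a LC"

definition sup_LC :: "'a LC \<Rightarrow> 'a LC \<Rightarrow> 'a LC"
  where "sup p q =
    (case (Rep_LC p, Rep_LC q) of ((x, y), (a, b)) \<Rightarrow> LC_normal (sup x a) (inf y b))"

lemma Rep_LC_normal: "Rep_LC (LC_normal a b) = (himp b a, sup b (himp b a))"
proof -
  have "himp (sup b (himp b a)) (himp b a) \<le> himp b a"
  proof -
    let ?c = "himp (sup b (himp b a)) (himp b a)"
    have "inf ?c (sup b (himp b a)) \<le> himp b a" by (simp add: inf_le_iff_le_himp)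
    then have "inf ?c b \<le> himp b a" by (meson inf_mono order_refl order_trans sup_ge1)
    then have "inf (inf ?c b) b \<le> a" by (simp only: inf_le_iff_le_himp)
    then show ?thesis by (simp add: inf.assoc inf_le_iff_le_himp)
  qed
  moreover have "himp b a \<le> himp (sup b (himp b a)) (himp b a)"
    by (rule iffD1[OF inf_le_iff_le_himp inf_le1])
  ultimately show ?thesis
    unfolding LC_normal_def by (subst Abs_LC_inverse) (auto intro: antisym)
qed

lemma LC_upper:
  fixes x y a b :: 'a
  shows "x \<le> himp (inf y b) (sup x a)"
    "sup (inf y b) (himp (inf y b) (sup x a)) \<le> sup (himp (inf y b) (sup x a)) y"
  by (auto simp: inf_le_iff_le_himp[symmetric] intro: le_infI1 le_supI1 le_supI2)

instance
proof
  fix p q r :: "'a LC"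
  show "p < q \<longleftrightarrow> p \<le> q \<and> \<not> q \<le> p" by (rule less_LC_def)
  show "p \<le> p" by (auto simp: less_eq_LC_def split: prod.splits)
  obtain x y where p: "Rep_LC p = (x, y)" by fastforce
  obtain a b where q: "Rep_LC q = (a, b)" by fastforce
  obtain u v where r: "Rep_LC r = (u, v)" by fastforce
  have xy: "x \<le> y" and ab: "a \<le> b" and uv: "himp v u = u"
    using Rep_LC[of p] Rep_LC[of q] Rep_LC[of r] p q r by auto
  show "p \<le> r" if "p \<le> q" "q \<le> r"
  proof -
    have *: "x \<le> a" "b \<le> sup a y" "a \<le> u" "v \<le> sup u b"
      using that p q r by (auto simp: less_eq_LC_def)
    have "b \<le> sup u y"
      using *(2) sup_mono[OF *(3) order_refl[of y]] by (rule order_trans)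
    then have "sup u b \<le> sup u y" by simp
    with *(4) have "v \<le> sup u y" by (rule order_trans)
    moreover have "x \<le> u" using *(1,3) by (rule order_trans)
    ultimately show ?thesis using p r by (simp add: less_eq_LC_def)
  qed
  show "p = q" if "p \<le> q" "q \<le> p"
  proof -
    have *: "x = a" "b \<le> sup a y" "y \<le> sup x b"
      using that p q by (auto simp: less_eq_LC_def)
    then have "y = b" using xy ab by (simp add: sup_absorb2)
    with * show ?thesis using p q by (metis Rep_LC_inject)
  qed
  have s: "Rep_LC (sup p q) =
      (himp (inf y b) (sup x a), sup (inf y b) (himp (inf y b) (sup x a)))"
    by (simp add: sup_LC_def p q Rep_LC_normal)
  show "p \<le> sup p q"
    using LC_upper[where x = x and y = y and a = a and b = b] by (simp add: less_eq_LC_def p s)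
  show "q \<le> sup p q"
    using LC_upper[where x = a and y = b and a = x and b = y] by (simp add: less_eq_LC_def q s inf.commute sup.commute)
  show "sup p q \<le> r" if "p \<le> r" "q \<le> r"
  proof -
    let ?c = "himp (inf y b) (sup x a)"
    have *: "sup x a \<le> u" "v \<le> sup u (inf y b)"
      using that p q r by (auto simp: less_eq_LC_def sup_inf_distrib1)
    have "inf ?c v \<le> inf ?c (sup u (inf y b))"
      by (rule inf_mono[OF order_refl *(2)])
    also have "\<dots> = sup (inf ?c u) (inf ?c (inf y b))" by (rule inf_sup_distrib1)
    also have "\<dots> \<le> sup u (sup x a)"
      by (rule sup_mono[OF inf_le2 iffD2[OF inf_le_iff_le_himp order_refl]])
    also have "\<dots> \<le> u" using * by simp
    finally have "?c \<le> himp v u" by (rule iffD1[OF inf_le_iff_le_himp])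
    then have "?c \<le> u" by (simp only: uv)
    moreover have "v \<le> sup u (sup (inf y b) ?c)"
      by (rule order_trans[OF *(2) sup_mono[OF order_refl sup_ge1]])
    ultimately show ?thesis by (simp add: less_eq_LC_def r s)
  qed
qed

end

text \<open>Admissibility of a family depends only on its range, so families are given as sets.
  The empty family is allowed.\<close>

definition admissible :: "'s::semilattice_sup set \<Rightarrow> bool"
  where "admissible A \<longleftrightarrow>
    (\<exists>m. isGlb UNIV A m \<and> (\<forall>b. isGlb UNIV (sup b ` A) (sup b m)))"

definition AU :: "'s::semilattice_sup set set"
  where "AU = {U. U \<noteq> {} \<and> (\<forall>x\<in>U. \<forall>y. x \<le> y \<longrightarrow> y \<in> U) \<and>
    (\<forall>A m. A \<subseteq> U \<and> admissible A \<and> isGlb UNIV A m \<longrightarrow> m \<in> U)}"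

end

theory Submission
  imports Defs
begin

text \<open>
  The isomorphism sends \<open>S\<close> to the set of all locally closed sublocales contained in \<open>S\<close>. Its
  properties rest on one separation fact: if \<open>x\<close> lies outside a sublocale \<open>T\<close> and \<open>v\<close> is the least
  element of \<open>T\<close> above \<open>x\<close>, then the locally closed sublocale presented by \<open>(x, v)\<close> meets \<open>T\<close> only
  in the top element, but it shares \<open>v \<rightarrow> x \<noteq> \<top>\<close> with every sublocale containing \<open>x\<close>.
  Hence an admissible meet in \<open>LC\<close> presents the join of the family of sublocales. Conversely, as
  meeting with a locally closed sublocale distributes over joins, a locally closed sublocale covered
  by a join \<open>\<Squnion>\<^sub>i C\<^sub>i\<close> is the admissible meet in \<open>LC\<close> of its intersections with the \<open>C\<^sub>i\<close>.
\<close>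

section \<open>Heyting implication and open sublocales\<close>

lemma himp_inf: "himp (inf a b) c = himp a (himp b (c::'a::frame))"
proof -
  have "x \<le> himp (inf a b) c \<longleftrightarrow> x \<le> himp a (himp b c)" for x
    by (simp add: inf_le_iff_le_himp[symmetric] inf.assoc)
  then show ?thesis by (meson order.antisym order_refl)
qed

lemma le_himp: "b \<le> himp a (b::'a::frame)"
  by (simp add: inf_le_iff_le_himp[symmetric])

lemma himp_mono: "b \<le> c \<Longrightarrow> himp a b \<le> himp a (c::'a::frame)"
  by (metis inf_le_iff_le_himp order_refl order_trans)

lemma inf_himp_le: "inf (himp a b) a \<le> (b::'a::frame)"
  by (simp add: inf_le_iff_le_himp)

lemma himp_antimono:
  assumes "a \<le> b"
  shows "himp b c \<le> himp a (c::'a::frame)"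
proof -
  have "inf (himp b c) a \<le> inf (himp b c) b" using assms by (simp add: le_infI2)
  also have "\<dots> \<le> c" by (rule inf_himp_le)
  finally show ?thesis by (simp add: inf_le_iff_le_himp)
qed

lemma himp_idem: "himp a (himp a b) = himp a (b::'a::frame)"
  by (simp add: himp_inf[symmetric])

lemma himp_eq_top_iff: "himp a b = top \<longleftrightarrow> a \<le> (b::'a::frame)"
  using inf_le_iff_le_himp[of top a b] by (simp add: top.extremum_unique)

text \<open>As \<open>himp b\<close> is idempotent, its range is its set of fixed points, so
  membership becomes an equation.\<close>

lemma mem_open_sublocale_iff: "z \<in> open_sublocale b \<longleftrightarrow> himp b z = z"
proof
  show "himp b z = z" if "z \<in> open_sublocale b"
    using that by (auto simp: open_sublocale_def himp_idem)
  show "z \<in> open_sublocale b" if "himp b z = z"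
    unfolding open_sublocale_def using that[symmetric] by (rule range_eqI)
qed

section \<open>\<open>LC\<close> as the reversed order of locally closed sublocales\<close>

definition lc :: "'a::frame LC \<Rightarrow> 'a set"
  where "lc p = closed_sublocale (fst (Rep_LC p)) \<inter> open_sublocale (snd (Rep_LC p))"

lemma mem_lc_iff: "z \<in> lc p \<longleftrightarrow> fst (Rep_LC p) \<le> z \<and> himp (snd (Rep_LC p)) z = z"
  by (simp add: lc_def closed_sublocale_def mem_open_sublocale_iff)

lemma locally_closed_lc: "locally_closed (lc p)"
  unfolding lc_def by (rule locally_closedI)

lemma sublocale_of_lc: "sublocale_of (lc p)"
  using locally_closed_lc by (auto simp: locally_closed_def)

lemma top_mem_sublocale: "sublocale_of S \<Longrightarrow> top \<in> S"
  unfolding sublocale_of_def by (metis Inf_empty empty_subsetI)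

lemma himp_mem_sublocale: "sublocale_of S \<Longrightarrow> s \<in> S \<Longrightarrow> himp a s \<in> S"
  by (simp add: sublocale_of_def)

text \<open>Normalizing a pair does not change the sublocale. Hence \<open>lc\<close> reaches every
  locally closed sublocale, and \<open>sup\<close> in \<open>LC\<close> becomes
  intersection.\<close>

lemma lc_LC_normal: "lc (LC_normal a b) = closed_sublocale a \<inter> open_sublocale b"
proof (rule set_eqI)
  fix z
  let ?c = "himp b a"
  have "?c \<le> z \<and> himp (sup b ?c) z = z \<longleftrightarrow> a \<le> z \<and> himp b z = z"
  proof
    assume z: "?c \<le> z \<and> himp (sup b ?c) z = z"
    \<comment> \<open>Distribute over \<open>sup b ?c\<close>: the first part lies below
      \<open>z\<close> by modus ponens, the second below \<open>?c\<close>, hence also below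
      \<open>z\<close>.\<close>
    have "inf (himp b z) (sup b ?c) \<le> sup z ?c"
      by (simp add: inf_sup_distrib1 inf_himp_le le_supI1 le_supI2)
    then have "inf (himp b z) (sup b ?c) \<le> z"
      using z by (simp add: sup_absorb1)
    then have "himp b z \<le> z"
      using z by (simp add: inf_le_iff_le_himp)
    then show "a \<le> z \<and> himp b z = z"
      using z le_himp by (metis antisym order_trans)
  next
    assume z: "a \<le> z \<and> himp b z = z"
    then have "?c \<le> z" by (metis himp_mono)
    moreover have "himp (sup b ?c) z \<le> z"
      using himp_antimono[of b "sup b ?c" z] z by simp
    ultimately show "?c \<le> z \<and> himp (sup b ?c) z = z"
      by (simp add: antisym le_himp)
  qed
  then show "z \<in> lc (LC_normal a b) \<longleftrightarrow> z \<in> closed_sublocale a \<inter> open_sublocale b"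
    by (simp add: mem_lc_iff Rep_LC_normal closed_sublocale_def mem_open_sublocale_iff)
qed

lemma locally_closed_iff_lc: "locally_closed S \<longleftrightarrow> (\<exists>p. S = lc p)"
  by (metis lc_LC_normal locally_closed_def locally_closed_lc)

lemma LC_le_iff_lc_subset: "p \<le> q \<longleftrightarrow> lc q \<subseteq> lc p"
proof -
  obtain x y where p: "Rep_LC p = (x, y)" by fastforce
  obtain a b where q: "Rep_LC q = (a, b)" by fastforce
  have ab: "himp b a = a" using Rep_LC[of q] q by auto
  have "x \<le> a \<and> b \<le> sup a y \<longleftrightarrow> lc q \<subseteq> lc p"
  proof
    assume *: "x \<le> a \<and> b \<le> sup a y"
    show "lc q \<subseteq> lc p"
    proof
      fix z assume "z \<in> lc q"
      then have z: "a \<le> z" "himp b z = z" by (auto simp: mem_lc_iff q)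
      have "inf (himp y z) b \<le> inf (himp y z) (sup a y)"
        using * by (simp add: le_infI2)
      also have "\<dots> \<le> z"
        using z(1) by (simp add: inf_sup_distrib1 inf_himp_le le_infI2)
      finally have "himp y z \<le> z"
        using z(2) by (simp add: inf_le_iff_le_himp)
      then show "z \<in> lc p"
        using * z(1) by (auto simp: mem_lc_iff p le_himp intro: antisym)
    qed
  next
    assume sub: "lc q \<subseteq> lc p"
    \<comment> \<open>The normal form of \<open>q\<close> enters here: it puts \<open>a\<close>
      itself into \<open>lc q\<close>.\<close>
    have "a \<in> lc q" by (simp add: mem_lc_iff q ab)
    then have "x \<le> a" using sub by (auto simp: mem_lc_iff p)
    moreover have "b \<le> sup a y"
    proof -
      \<comment> \<open>The least element of the open sublocale of \<open>b\<close> above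
        \<open>sup a y\<close>. It lies in \<open>lc q\<close>, so \<open>himp y\<close> must fix
        it; but \<open>y\<close> is below it, so it is \<open>top\<close>.\<close>
      let ?z = "himp b (sup a y)"
      have le: "sup a y \<le> ?z" by (rule le_himp)
      then have "?z \<in> lc q" by (simp add: mem_lc_iff q himp_idem)
      then have "himp y ?z = ?z" using sub by (auto simp: mem_lc_iff p)
      moreover have "himp y ?z = top" using le by (simp add: himp_eq_top_iff)
      ultimately show ?thesis by (metis himp_eq_top_iff)
    qed
    ultimately show "x \<le> a \<and> b \<le> sup a y" ..
  qed
  then show ?thesis by (simp add: less_eq_LC_def p q)
qed

lemma open_sublocale_inf: "open_sublocale (inf a b) = open_sublocale a \<inter> open_sublocale b"
proof (rule set_eqI)
  fix z
  have "himp a z = z \<and> himp b z = z" if "himp (inf a b) z = z"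
    by (metis that antisym himp_antimono inf_le1 inf_le2 le_himp)
  then show "z \<in> open_sublocale (inf a b) \<longleftrightarrow> z \<in> open_sublocale a \<inter> open_sublocale b"
    by (auto simp: mem_open_sublocale_iff himp_inf)
qed

lemma lc_sup: "lc (sup p q) = lc p \<inter> lc q"
proof -
  obtain x y where p: "Rep_LC p = (x, y)" by fastforce
  obtain a b where q: "Rep_LC q = (a, b)" by fastforce
  have "lc (sup p q) = closed_sublocale (sup x a) \<inter> open_sublocale (inf y b)"
    by (simp add: sup_LC_def p q lc_LC_normal)
  also have "\<dots> = lc p \<inter> lc q"
    by (auto simp: lc_def p q open_sublocale_inf closed_sublocale_def)
  finally show ?thesis .
qed

text \<open>The least sublocale \<open>{top}\<close> is presented by the greatest element
  \<open>t\<close> of \<open>LC\<close>. Trivial intersection thus reads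
  \<open>t \<le> sup d p\<close>, a condition that greatest lower bounds in \<open>LC\<close> can
  detect.\<close>

lemma lc_trivial_exists: "\<exists>t::'a::frame LC. lc t = {top}"
proof
  show "lc (LC_normal top top) = {top::'a}"
    by (auto simp: lc_LC_normal closed_sublocale_def mem_open_sublocale_iff himp_eq_top_iff
        top.extremum_unique)
qed

section \<open>Separation, and trivial intersection with joins\<close>

lemma separating_LC:
  fixes T :: "'a::frame set"
  assumes T: "sublocale_of T" and x: "x \<notin> T"
  obtains d where "lc d \<inter> T = {top}"
    and "\<And>R. sublocale_of R \<Longrightarrow> x \<in> R \<Longrightarrow> \<not> lc d \<inter> R \<subseteq> {top}"
proof (rule that)
  define v where "v = Inf {t \<in> T. x \<le> t}"
  have "v \<in> T" using T unfolding v_def sublocale_of_def by simp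
  moreover have "x \<le> v" unfolding v_def by (rule Inf_greatest) simp
  ultimately have v: "\<not> v \<le> x" using x by (metis antisym)
  have mem: "z \<in> lc (LC_normal x v) \<longleftrightarrow> x \<le> z \<and> himp v z = z" for z
    by (simp add: lc_LC_normal closed_sublocale_def mem_open_sublocale_iff)
  show "lc (LC_normal x v) \<inter> T = {top}"
  proof
    show "lc (LC_normal x v) \<inter> T \<subseteq> {top}"
    proof
      fix z assume "z \<in> lc (LC_normal x v) \<inter> T"
      then have z: "x \<le> z" "himp v z = z" "z \<in> T" by (auto simp: mem)
      then have "v \<le> z" unfolding v_def by (auto intro: Inf_lower)
      then show "z \<in> {top}" using z(2) by (simp add: himp_eq_top_iff[symmetric])
    qed
    show "{top} \<subseteq> lc (LC_normal x v) \<inter> T"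
      using top_mem_sublocale[OF T] top_mem_sublocale[OF sublocale_of_lc] by simp
  qed
  fix R assume R: "sublocale_of R" "x \<in> R"
  have "himp v x \<in> lc (LC_normal x v) \<inter> R"
    using himp_mem_sublocale[OF R] by (simp add: mem le_himp himp_idem)
  moreover have "himp v x \<noteq> top" using v by (simp add: himp_eq_top_iff)
  ultimately show "\<not> lc (LC_normal x v) \<inter> R \<subseteq> {top}" by blast
qed

text \<open>The case of distributivity over joins that is needed. Write \<open>y = Inf N\<close>;
  then \<open>y = himp b y\<close> is the meet of all \<open>himp b n\<close>, and each of these
  lies both in \<open>lc e\<close> and in a member of \<open>F\<close>, hence is
  \<open>top\<close>.\<close>

lemma lc_inf_sublocale_Join_trivial:
  assumes F: "\<And>S. S \<in> F \<Longrightarrow> sublocale_of S"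
    and disj: "\<And>S. S \<in> F \<Longrightarrow> lc e \<inter> S \<subseteq> {top}"
  shows "lc e \<inter> sublocale_Join F \<subseteq> {top}"
proof
  fix y assume y: "y \<in> lc e \<inter> sublocale_Join F"
  obtain a b where e: "Rep_LC e = (a, b)" by fastforce
  obtain N where N: "N \<subseteq> \<Union>F" "y = Inf N"
    using y by (auto simp: sublocale_Join_def)
  have ay: "a \<le> y" "himp b y = y" using y by (auto simp: mem_lc_iff e)
  have "himp b n = top" if n: "n \<in> N" for n
  proof -
    obtain S where S: "S \<in> F" "n \<in> S" using N n by blast
    have "a \<le> n" using ay(1) N(2) n by (metis Inf_lower order_trans)
    then have "himp b n \<in> lc e"
      using le_himp order_trans by (fastforce simp: mem_lc_iff e himp_idem)
    moreover have "himp b n \<in> S" using himp_mem_sublocale[OF F] S by blast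
    ultimately show ?thesis using disj S(1) by blast
  qed
  then have "Inf (himp b ` N) = top" by auto
  then show "y \<in> {top}" using ay(2) N(2) by (simp add: himp_Inf)
qed

section \<open>Admissible meets in \<open>LC\<close> against joins of sublocales\<close>

lemma isGlb_UNIV_iff: "isGlb UNIV A m \<longleftrightarrow> (\<forall>a\<in>A. m \<le> a) \<and> (\<forall>c. (\<forall>a\<in>A. c \<le> a) \<longrightarrow> c \<le> m)"
  by (auto simp: isGlb_def greatestP_def isLb_def setge_def setle_def)

text \<open>If \<open>x\<close> in \<open>lc m\<close> were outside \<open>T\<close>, a separating
  \<open>d\<close> would meet every \<open>lc p\<close> trivially. Admissibility carries this over
  to \<open>lc m\<close>, which contains \<open>x\<close>, against the choice of
  \<open>d\<close>.\<close>

lemma lc_admissible_meet_subset: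
  assumes A: "admissible A" "isGlb UNIV A m"
    and T: "sublocale_of T" "\<And>p. p \<in> A \<Longrightarrow> lc p \<subseteq> T"
  shows "lc m \<subseteq> T"
proof (rule ccontr)
  assume "\<not> lc m \<subseteq> T"
  then obtain x where x: "x \<in> lc m" "x \<notin> T" by blast
  obtain d where d: "lc d \<inter> T = {top}"
    and sep: "\<And>R. sublocale_of R \<Longrightarrow> x \<in> R \<Longrightarrow> \<not> lc d \<inter> R \<subseteq> {top}"
    using separating_LC[OF T(1) x(2)] by blast
  obtain t :: "'a LC" where t: "lc t = {top}" using lc_trivial_exists by blast
  obtain m' where m': "isGlb UNIV A m'" "isGlb UNIV (sup d ` A) (sup d m')"
    using A(1) by (auto simp: admissible_def)
  have "m' = m" using A(2) m'(1) by (auto simp: isGlb_UNIV_iff intro: antisym)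
  moreover have "t \<le> sup d p" if "p \<in> A" for p
    using T(2)[OF that] d by (auto simp: LC_le_iff_lc_subset lc_sup t)
  ultimately have "t \<le> sup d m" using m'(2) by (auto simp: isGlb_UNIV_iff)
  then show False
    using sep[OF sublocale_of_lc x(1)] by (simp add: LC_le_iff_lc_subset lc_sup t)
qed

text \<open>For a lower bound \<open>c\<close> not below \<open>p\<close>, separate a point of
  \<open>lc p\<close> from \<open>lc c\<close> by some \<open>d\<close>. As
  \<open>lc p \<inter> lc q \<subseteq> lc c\<close> for all \<open>q\<close> in \<open>U\<close>,
  \<open>lc (sup d p)\<close> meets each \<open>lc q\<close> trivially, hence also their join, which
  covers \<open>lc p\<close>: a contradiction.\<close>

lemma isGlb_sup_of_lc_cover:
  assumes cover: "lc p \<subseteq> sublocale_Join (lc ` U)"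
  shows "isGlb UNIV (sup p ` U) p"
proof -
  have "c \<le> p" if c: "\<And>q. q \<in> U \<Longrightarrow> c \<le> sup p q" for c
  proof (rule ccontr)
    assume "\<not> c \<le> p"
    then obtain x where x: "x \<in> lc p" "x \<notin> lc c" by (auto simp: LC_le_iff_lc_subset)
    obtain d where d: "lc d \<inter> lc c = {top}"
      and sep: "\<And>R. sublocale_of R \<Longrightarrow> x \<in> R \<Longrightarrow> \<not> lc d \<inter> R \<subseteq> {top}"
      using separating_LC[OF sublocale_of_lc x(2)] by blast
    have "lc (sup d p) \<inter> sublocale_Join (lc ` U) \<subseteq> {top}"
    proof (rule lc_inf_sublocale_Join_trivial)
      fix S assume "S \<in> lc ` U"
      then obtain q where q: "S = lc q" "q \<in> U" by blast
      show "sublocale_of S" by (simp add: q sublocale_of_lc)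
      show "lc (sup d p) \<inter> S \<subseteq> {top}"
        using c[OF q(2)] d by (auto simp: LC_le_iff_lc_subset lc_sup q(1))
    qed
    then have "lc d \<inter> lc p \<subseteq> {top}" using cover by (auto simp: lc_sup)
    then show False using sep[OF sublocale_of_lc x(1)] by simp
  qed
  then show ?thesis by (auto simp: isGlb_UNIV_iff)
qed

text \<open>The covering hypothesis passes from \<open>p\<close> to each \<open>sup b p\<close>, so
  the previous lemma yields the distributivity condition as well.\<close>

lemma admissible_sup_of_lc_cover:
  assumes cover: "lc p \<subseteq> sublocale_Join (lc ` U)"
  shows "admissible (sup p ` U)"
proof -
  have "isGlb UNIV (sup b ` sup p ` U) (sup b p)" for b
  proof -
    have "lc (sup b p) \<subseteq> sublocale_Join (lc ` U)"
      using cover unfolding lc_sup by (rule le_infI2)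
    then have "isGlb UNIV (sup (sup b p) ` U) (sup b p)"
      by (rule isGlb_sup_of_lc_cover)
    moreover have "sup (sup b p) ` U = sup b ` sup p ` U" by (auto simp: image_iff sup.assoc)
    ultimately show ?thesis by simp
  qed
  with isGlb_sup_of_lc_cover[OF cover] show ?thesis
    unfolding admissible_def by blast
qed

section \<open>The isomorphism\<close>

lemma Sb_iff: "S \<in> Sb \<longleftrightarrow> (\<exists>U. S = sublocale_Join (lc ` U))"
proof
  assume "S \<in> Sb"
  then obtain F where F: "S = sublocale_Join F" "\<forall>C\<in>F. locally_closed C"
    by (auto simp: Sb_def)
  then have "F \<subseteq> range lc" by (fastforce simp: locally_closed_iff_lc)
  then obtain U where "F = lc ` U" by (auto simp: subset_image_iff)
  with F(1) show "\<exists>U. S = sublocale_Join (lc ` U)" by blast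
next
  assume "\<exists>U. S = sublocale_Join (lc ` U)"
  then show "S \<in> Sb" using locally_closed_lc unfolding Sb_def by blast
qed

lemma sublocale_Join_lc:
  shows sublocale_of_sublocale_Join_lc: "sublocale_of (sublocale_Join (lc ` U))"
    and lc_subset_sublocale_Join: "p \<in> U \<Longrightarrow> lc p \<subseteq> sublocale_Join (lc ` U)"
    and sublocale_Join_lc_least:
      "sublocale_of T \<Longrightarrow> (\<And>p. p \<in> U \<Longrightarrow> lc p \<subseteq> T) \<Longrightarrow> sublocale_Join (lc ` U) \<subseteq> T"
proof -
  have F: "sublocale_of S" if "S \<in> lc ` U" for S using that sublocale_of_lc by blast
  show "sublocale_of (sublocale_Join (lc ` U))"
    using sublocale_Join_is_join(1) F by blast
  show "p \<in> U \<Longrightarrow> lc p \<subseteq> sublocale_Join (lc ` U)"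
    using sublocale_Join_is_join(2)[of "lc ` U"] F by blast
  show "sublocale_of T \<Longrightarrow> (\<And>p. p \<in> U \<Longrightarrow> lc p \<subseteq> T) \<Longrightarrow> sublocale_Join (lc ` U) \<subseteq> T"
    by (rule sublocale_Join_is_join(3)[of "lc ` U"]) (use F in auto)
qed

lemma lc_below_in_AU:
  assumes S: "sublocale_of S"
  shows "{p. lc p \<subseteq> S} \<in> AU"
  unfolding AU_def mem_Collect_eq
proof (intro conjI ballI allI impI)
  obtain t :: "'a LC" where "lc t = {top}" using lc_trivial_exists by blast
  then have "t \<in> {p. lc p \<subseteq> S}" using top_mem_sublocale[OF S] by simp
  then show "{p. lc p \<subseteq> S} \<noteq> {}" by blast
next
  fix p q assume "p \<in> {p. lc p \<subseteq> S}" "p \<le> q"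
  then show "lc q \<subseteq> S" unfolding LC_le_iff_lc_subset by blast
next
  fix A m assume A: "A \<subseteq> {p. lc p \<subseteq> S} \<and> admissible A \<and> isGlb UNIV A m"
  show "lc m \<subseteq> S"
  proof (rule lc_admissible_meet_subset[OF _ _ S])
    show "admissible A" "isGlb UNIV A m" using A by simp_all
    show "lc p \<subseteq> S" if "p \<in> A" for p using A that by blast
  qed
qed

lemma AU_upper: "U \<in> AU \<Longrightarrow> x \<in> U \<Longrightarrow> x \<le> y \<Longrightarrow> y \<in> U"
  by (simp add: AU_def)

lemma AU_admissible_meet: "U \<in> AU \<Longrightarrow> A \<subseteq> U \<Longrightarrow> admissible A \<Longrightarrow> isGlb UNIV A m \<Longrightarrow> m \<in> U"
  by (simp add: AU_def)

text \<open>Gives surjectivity. A \<open>p\<close> covered by the join is the admissible meet of the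
  elements \<open>sup p q\<close> with \<open>q\<close> in \<open>U\<close>, and these lie in
  \<open>U\<close> because it is an upper set.\<close>

lemma AU_lc_below_Join:
  assumes U: "U \<in> AU"
  shows "{p. lc p \<subseteq> sublocale_Join (lc ` U)} = U"
proof (intro equalityI subsetI)
  fix p assume "p \<in> {p. lc p \<subseteq> sublocale_Join (lc ` U)}"
  then have p: "lc p \<subseteq> sublocale_Join (lc ` U)" by simp
  have "sup p q \<in> U" if "q \<in> U" for q
    using AU_upper[OF U that] by simp
  then have "sup p ` U \<subseteq> U" by blast
  then show "p \<in> U"
    using AU_admissible_meet[OF U] admissible_sup_of_lc_cover[OF p] isGlb_sup_of_lc_cover[OF p]
    by blast
qed (use lc_subset_sublocale_Join in blast)

theorem corollary5p2:
  shows "\<exists>f :: 'a::frame set \<Rightarrow> 'a LC set.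
    bij_betw f (Sb :: 'a set set) (AU :: 'a LC set set) \<and>
    (\<forall>S\<in>Sb. \<forall>T\<in>Sb. S \<subseteq> T \<longleftrightarrow> f S \<subseteq> f T)"
proof (intro exI conjI ballI)
  let ?f = "\<lambda>S::'a set. {p. lc p \<subseteq> S}"
  have sub: "sublocale_of S" if "S \<in> Sb" for S :: "'a set"
    using that by (auto simp: Sb_iff sublocale_of_sublocale_Join_lc)
  have embed: "S \<subseteq> T \<longleftrightarrow> ?f S \<subseteq> ?f T" if "S \<in> Sb" "T \<in> Sb" for S T
  proof
    \<comment> \<open>Inclusion is reflected because \<open>S\<close> is a join of sublocales
      \<open>lc p\<close> with \<open>p\<close> in \<open>?f S\<close>. Injectivity follows from
      this too.\<close>
    assume le: "?f S \<subseteq> ?f T"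
    obtain U where U: "S = sublocale_Join (lc ` U)" using \<open>S \<in> Sb\<close> by (auto simp: Sb_iff)
    have "lc p \<subseteq> T" if "p \<in> U" for p
      using lc_subset_sublocale_Join[OF that] le U by blast
    then show "S \<subseteq> T"
      unfolding U by (rule sublocale_Join_lc_least[OF sub[OF \<open>T \<in> Sb\<close>]])
  qed blast
  then show "S \<subseteq> T \<longleftrightarrow> ?f S \<subseteq> ?f T" if "S \<in> Sb" "T \<in> Sb" for S T
    using that by blast
  show "bij_betw ?f Sb AU"
    unfolding bij_betw_def
  proof
    show "inj_on ?f Sb"
      by (rule inj_onI) (metis embed order_refl subset_antisym)
    show "?f ` Sb = AU"
    proof
      show "?f ` Sb \<subseteq> AU" using sub lc_below_in_AU by blast
      show "AU \<subseteq> ?f ` Sb"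
      proof
        fix U :: "'a LC set" assume "U \<in> AU"
        then show "U \<in> ?f ` Sb"
          by (intro image_eqI[where x = "sublocale_Join (lc ` U)"])
            (auto simp: AU_lc_below_Join Sb_iff)
      qed
    qed
  qed
qed

end
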